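(* Let $x$ be a number. Then $x$ is indecomposable if and only if $|x|\leqslant 1$.
   Context: All games are short (finite) two-player partizan combinatorial games under normal play (a player who cannot move loses). $+$ denotes the disjunctive sum, and $=$ denotes the usual equality of game values. A number is a short game equal to a dyadic rational (an integer or an irreducible fraction whose denominator is a power of $2$), with the usual identification of dyadic rationals with game values. The birthday $b(G)$ is the height of the game tree of the canonical form of $G$. A game $G$ is decomposable if there are (arbitrary short) games $H$ and $J$ such that $b(H)<b(G)$, $b(J)<b(G)$ and $G=H+J$. If there are no such $H,J$, then $G$ is indecomposable. *)

theory Defs
  imports Complex_Main "HOL-Library.FSet"
begin

datatype game = Game (lefts: "game fset") (rights: "game fset")

primrec height :: "game \<Rightarrow> nat" where
  "height (Game L R) =
     Max (insert 0 (Suc ` (fset (height |`| L) \<union> fset (height |`| R))))"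

lemma height_option_less:
  assumes "X |\<in>| lefts G |\<union>| rights G"
  shows "height X < height G"
proof (cases G)
  case (Game L R)
  have "Suc (height X) \<in> insert 0 (Suc ` (fset (height |`| L) \<union> fset (height |`| R)))"
    using assms Game by auto
  then have "Suc (height X) \<le> height G"
    unfolding Game height.simps by (intro Max_ge) auto
  then show ?thesis by simp
qed

lemma height_left_less [simp]: "X |\<in>| lefts G \<Longrightarrow> height X < height G"
  and height_right_less [simp]: "X |\<in>| rights G \<Longrightarrow> height X < height G"
  by (simp_all add: height_option_less)

(* Disjunctive sum; the congruence rule is needed for termination of recursion through fimage. *)

lemmas [fundef_cong] = fset.map_cong

function game_plus :: "game \<Rightarrow> game \<Rightarrow> game" (infixl \<open>\<oplus>\<close> 65) where
  "G \<oplus> H = Game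
     ((\<lambda>X. X \<oplus> H) |`| lefts G |\<union>| (\<lambda>Y. G \<oplus> Y) |`| lefts H)
     ((\<lambda>X. X \<oplus> H) |`| rights G |\<union>| (\<lambda>Y. G \<oplus> Y) |`| rights H)"
  by pat_completeness auto
termination
  by (relation "measure (\<lambda>(G, H). height G + height H)") auto

declare game_plus.simps [simp del]

(* Conway's recursive order for normal play: G is at most H iff, in H - G, Right moving first
   has no winning move, i.e. no left option of G is at least H and no right option of H is at
   most G. *)

function game_le :: "game \<Rightarrow> game \<Rightarrow> bool" (infix \<open>\<preceq>\<close> 50) where
  "G \<preceq> H \<longleftrightarrow> fBall (lefts G) (\<lambda>X. \<not> H \<preceq> X) \<and> fBall (rights H) (\<lambda>Y. \<not> Y \<preceq> G)"
  by pat_completeness auto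
termination
  by (relation "measure (\<lambda>(G, H). height G + height H)") auto

declare game_le.simps [simp del]

definition game_eq :: "game \<Rightarrow> game \<Rightarrow> bool" (infix \<open>\<approx>\<close> 50) where
  "G \<approx> H \<longleftrightarrow> G \<preceq> H \<and> H \<preceq> G"

inductive subposition :: "game \<Rightarrow> game \<Rightarrow> bool" where
  subposition_refl: "subposition G G"
| subposition_left: "X |\<in>| lefts G \<Longrightarrow> subposition H X \<Longrightarrow> subposition H G"
| subposition_right: "X |\<in>| rights G \<Longrightarrow> subposition H X \<Longrightarrow> subposition H G"

definition has_dominated_option :: "game \<Rightarrow> bool" where
  "has_dominated_option G \<longleftrightarrow>
     (\<exists>X Y. X |\<in>| lefts G \<and> Y |\<in>| lefts G \<and> X \<noteq> Y \<and> X \<preceq> Y) \<or>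
     (\<exists>X Y. X |\<in>| rights G \<and> Y |\<in>| rights G \<and> X \<noteq> Y \<and> Y \<preceq> X)"

definition has_reversible_option :: "game \<Rightarrow> bool" where
  "has_reversible_option G \<longleftrightarrow>
     (\<exists>X Z. X |\<in>| lefts G \<and> Z |\<in>| rights X \<and> Z \<preceq> G) \<or>
     (\<exists>X Z. X |\<in>| rights G \<and> Z |\<in>| lefts X \<and> G \<preceq> Z)"

definition canonical :: "game \<Rightarrow> bool" where
  "canonical G \<longleftrightarrow>
     (\<forall>H. subposition H G \<longrightarrow> \<not> has_dominated_option H \<and> \<not> has_reversible_option H)"

(* Every short game equals exactly one canonical game, identity being structural because
   options form finite sets. *)

definition canonical_form :: "game \<Rightarrow> game" where
  "canonical_form G = (THE K. canonical K \<and> K \<approx> G)"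

definition birthday :: "game \<Rightarrow> nat" where
  "birthday G = height (canonical_form G)"

fun nat_game :: "nat \<Rightarrow> game" where
  "nat_game 0 = Game {||} {||}"
| "nat_game (Suc n) = Game {|nat_game n|} {||}"

fun neg_nat_game :: "nat \<Rightarrow> game" where
  "neg_nat_game 0 = Game {||} {||}"
| "neg_nat_game (Suc n) = Game {||} {|neg_nat_game n|}"

(* The game of the dyadic rational m / 2 ^ n. The fraction is first reduced; for odd m and
   n > 0, m / 2 ^ n is the game with options (m - 1) / 2 ^ n and (m + 1) / 2 ^ n. *)

fun dyadic_game :: "int \<Rightarrow> nat \<Rightarrow> game" where
  "dyadic_game m 0 = (if m \<ge> 0 then nat_game (nat m) else neg_nat_game (nat (- m)))"
| "dyadic_game m (Suc n) =
     (if even m then dyadic_game (m div 2) n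
      else Game {|dyadic_game ((m - 1) div 2) n|} {|dyadic_game ((m + 1) div 2) n|})"

definition has_number_value :: "game \<Rightarrow> rat \<Rightarrow> bool" where
  "has_number_value G x \<longleftrightarrow> (\<exists>m n. x = of_int m / 2 ^ n \<and> G \<approx> dyadic_game m n)"

definition decomposable :: "game \<Rightarrow> bool" where
  "decomposable G \<longleftrightarrow>
     (\<exists>H J. birthday H < birthday G \<and> birthday J < birthday G \<and> G \<approx> H \<oplus> J)"

definition indecomposable :: "game \<Rightarrow> bool" where
  "indecomposable G \<longleftrightarrow> \<not> decomposable G"

end

(* If H + J is a number x, then the left stop of H and the right stop of J add up to x. Stops of
   a game of height at most k + 1 are integer multiples of 1 / 2^k, as they are either stops of
   options or the simplest number between stops of options. A reduced m / 2^n in [-1, 1] has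
   birthday at most n + 1, so summands of smaller birthday have stops that are multiples of
   1 / 2^(n - 1) (or 0 if n = 0), which cannot add up to it. Conversely, for x > 1 the summands
   x - 1 and 1 have smaller birthdays, and symmetrically for x < -1.
   The left stop of H is encoded as the infimum of the numbers y with H <= y, and the right stop
   as the supremum of those with y <= H. *)

theory Submission
  imports Defs
begin

text \<open>Why a left stop is paired with a right stop: \<open>H \<oplus> J \<approx> x\<close>
  says that H equals x - J, so for a number y the game H lies below y exactly when x - y lies below
  J. Two left stops would only bound the left stop of the sum from above. With stops encoded by
  comparison with numbers, this duality follows from cancellation of summands, without analysing
  play in the sum.

  The obstacle on the other side is that a birthday is the height of a canonical form given by a
  definite description. Existence and uniqueness of canonical forms therefore come first, and games
  of dyadic rationals must be shown canonical before their birthdays can be read off. Summands are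
  replaced by their canonical forms, so that a bound on birthdays becomes a bound on heights, which
  controls the denominators of stops: one more level of height halves the mesh, because a new number
  can be taken as a midpoint of old ones. The final contradiction is one of parity, an odd numerator
  against a sum of two even ones.\<close>

section \<open>The order on games\<close>

lemma game_leI:
  assumes "\<And>X. X |\<in>| lefts G \<Longrightarrow> \<not> H \<preceq> X" "\<And>Y. Y |\<in>| rights H \<Longrightarrow> \<not> Y \<preceq> G"
  shows "G \<preceq> H"
  using assms by (subst game_le.simps) blast

lemma not_le_left: "G \<preceq> H \<Longrightarrow> X |\<in>| lefts G \<Longrightarrow> \<not> H \<preceq> X"
  by (subst (asm) game_le.simps) blast

lemma not_right_le: "G \<preceq> H \<Longrightarrow> Y |\<in>| rights H \<Longrightarrow> \<not> Y \<preceq> G"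
  by (subst (asm) game_le.simps) blast

lemma not_game_leE:
  assumes "\<not> G \<preceq> H"
  obtains X where "X |\<in>| lefts G" "H \<preceq> X" | Y where "Y |\<in>| rights H" "Y \<preceq> G"
  using assms game_leI by blast

lemma game_le_refl [simp]: "G \<preceq> G"
proof (induction "height G" arbitrary: G rule: less_induct)
  case less
  show ?case
  proof (rule game_leI)
    fix X assume X: "X |\<in>| lefts G"
    then show "\<not> G \<preceq> X" using less not_le_left[of G X X] by auto
  next
    fix X assume X: "X |\<in>| rights G"
    then show "\<not> X \<preceq> G" using less not_right_le[of X G X] by auto
  qed
qed

text \<open>If \<open>K \<preceq> X\<close> for a left option X of G, then the rotated triple H, K,
  X gives \<open>H \<preceq> X\<close>, against \<open>G \<preceq> H\<close>. Rotation is why the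
  induction runs on the sum of the three heights.\<close>

lemma game_le_trans: "G \<preceq> H \<Longrightarrow> H \<preceq> K \<Longrightarrow> G \<preceq> K"
proof (induction "height G + height H + height K" arbitrary: G H K rule: less_induct)
  case less
  show ?case
  proof (rule game_leI)
    fix X assume X: "X |\<in>| lefts G"
    then have "height H + height K + height X < height G + height H + height K" by simp
    then show "\<not> K \<preceq> X" using less.hyps[of H K X] less.prems not_le_left X by blast
  next
    fix X assume X: "X |\<in>| rights K"
    then have "height X + height G + height H < height G + height H + height K" by simp
    then show "\<not> X \<preceq> G" using less.hyps[of X G H] less.prems not_right_le X by blast
  qed
qed

lemma not_le_own_left: "X |\<in>| lefts G \<Longrightarrow> \<not> G \<preceq> X"
  by (rule not_le_left[OF game_le_refl])

lemma not_own_right_le: "X |\<in>| rights G \<Longrightarrow> \<not> X \<preceq> G"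
  by (rule not_right_le[OF game_le_refl])

lemma game_eq_refl [simp]: "G \<approx> G"
  by (simp add: game_eq_def)

lemma game_eq_sym: "G \<approx> H \<Longrightarrow> H \<approx> G"
  by (simp add: game_eq_def)

lemma game_eq_trans: "G \<approx> H \<Longrightarrow> H \<approx> K \<Longrightarrow> G \<approx> K"
  unfolding game_eq_def using game_le_trans by blast

section \<open>Disjunctive sums\<close>

lemma lefts_plus: "X |\<in>| lefts (G \<oplus> H) \<longleftrightarrow>
    (\<exists>G'. G' |\<in>| lefts G \<and> X = G' \<oplus> H) \<or> (\<exists>H'. H' |\<in>| lefts H \<and> X = G \<oplus> H')"
  by (subst game_plus.simps) auto

lemma rights_plus: "X |\<in>| rights (G \<oplus> H) \<longleftrightarrow>
    (\<exists>G'. G' |\<in>| rights G \<and> X = G' \<oplus> H) \<or> (\<exists>H'. H' |\<in>| rights H \<and> X = G \<oplus> H')"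
  by (subst game_plus.simps) auto

lemma game_plus_commute: "G \<oplus> H = H \<oplus> G"
proof (induction "height G + height H" arbitrary: G H rule: less_induct)
  case less
  have 1: "X \<oplus> H = H \<oplus> X" if "X |\<in>| lefts G |\<union>| rights G" for X
    using that by (intro less) (simp add: height_option_less)
  have 2: "G \<oplus> X = X \<oplus> G" if "X |\<in>| lefts H |\<union>| rights H" for X
    using that by (intro less) (simp add: height_option_less)
  show ?case
    by (rule game.expand) (auto simp: fset_eq_iff lefts_plus rights_plus 1 2; metis 1 2 funionCI)
qed

text \<open>Monotonicity and cancellation need one joint induction: a move in G or H reverses the
  comparison, so each direction uses the other one at smaller games.\<close>

lemma plus_le_cancel_right [simp]: "G \<oplus> K \<preceq> H \<oplus> K \<longleftrightarrow> G \<preceq> H"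
proof (induction "height G + height H + height K" arbitrary: G H K rule: less_induct)
  case less
  let ?n = "height G + height H + height K"
  show ?case
  proof
    assume le: "G \<preceq> H"
    show "G \<oplus> K \<preceq> H \<oplus> K"
    proof (rule game_leI)
      fix X assume "X |\<in>| lefts (G \<oplus> K)"
      then consider G' where "G' |\<in>| lefts G" "X = G' \<oplus> K" | K' where "K' |\<in>| lefts K" "X = G \<oplus> K'"
        by (auto simp: lefts_plus)
      then show "\<not> H \<oplus> K \<preceq> X"
      proof cases
        case 1
        then have "height H + height G' + height K < ?n" by simp
        then show ?thesis using less[of H G' K] 1 le not_le_left by blast
      next
        case 2
        \<comment> \<open>A move in K is mirrored in the other copy of K:
          \<open>H \<oplus> K \<preceq> G \<oplus> K'\<close> would put \<open>H \<oplus> K\<close>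
          below its own left option \<open>H \<oplus> K'\<close>.\<close>
        then have "G \<oplus> K' \<preceq> H \<oplus> K'" using less[of G H K'] le by simp
        moreover have "\<not> H \<oplus> K \<preceq> H \<oplus> K'"
          using 2 by (intro not_le_own_left) (auto simp: lefts_plus)
        ultimately show ?thesis using 2 game_le_trans by blast
      qed
    next
      fix X assume "X |\<in>| rights (H \<oplus> K)"
      then consider H' where "H' |\<in>| rights H" "X = H' \<oplus> K" | K' where "K' |\<in>| rights K" "X = H \<oplus> K'"
        by (auto simp: rights_plus)
      then show "\<not> X \<preceq> G \<oplus> K"
      proof cases
        case 1
        then have "height H' + height G + height K < ?n" by simp
        then show ?thesis using less[of H' G K] 1 le not_right_le by blast
      next
        case 2
        then have "G \<oplus> K' \<preceq> H \<oplus> K'" using less[of G H K'] le by simp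
        moreover have "\<not> G \<oplus> K' \<preceq> G \<oplus> K"
          using 2 by (intro not_own_right_le) (auto simp: rights_plus)
        ultimately show ?thesis using 2 game_le_trans by blast
      qed
    qed
  next
    assume le: "G \<oplus> K \<preceq> H \<oplus> K"
    show "G \<preceq> H"
    proof (rule game_leI)
      fix X assume X: "X |\<in>| lefts G"
      then have "height H + height X + height K < ?n" by simp
      moreover have "\<not> H \<oplus> K \<preceq> X \<oplus> K"
        using X by (intro not_le_left[OF le]) (auto simp: lefts_plus)
      ultimately show "\<not> H \<preceq> X" using less[of H X K] by blast
    next
      fix X assume X: "X |\<in>| rights H"
      then have "height X + height G + height K < ?n" by simp
      moreover have "\<not> X \<oplus> K \<preceq> G \<oplus> K"
        using X by (intro not_right_le[OF le]) (auto simp: rights_plus)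
      ultimately show "\<not> X \<preceq> G" using less[of X G K] by blast
    qed
  qed
qed

lemma plus_le_cancel_left [simp]: "K \<oplus> G \<preceq> K \<oplus> H \<longleftrightarrow> G \<preceq> H"
  by (simp add: game_plus_commute[of K])

lemma game_plus_cong:
  assumes "G \<approx> G'" "H \<approx> H'"
  shows "G \<oplus> H \<approx> G' \<oplus> H'"
  using assms game_le_trans[of "G \<oplus> H" "G' \<oplus> H" "G' \<oplus> H'"]
    game_le_trans[of "G' \<oplus> H'" "G' \<oplus> H" "G \<oplus> H"]
  by (simp add: game_eq_def)

section \<open>Negation\<close>

primrec neg :: "game \<Rightarrow> game" where
  "neg (Game L R) = Game (neg |`| R) (neg |`| L)"

lemma lefts_neg [simp]: "lefts (neg G) = neg |`| rights G"
  and rights_neg [simp]: "rights (neg G) = neg |`| lefts G"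
  by (cases G; simp)+

lemma neg_neg [simp]: "neg (neg G) = G"
  by (induction G) (auto simp: fset.map_comp o_def cong: fset.map_cong)

lemma neg_eq_iff [simp]: "neg G = neg H \<longleftrightarrow> G = H"
  by (metis neg_neg)

lemma neg_mem_lefts_neg: "neg X |\<in>| lefts (neg G) \<longleftrightarrow> X |\<in>| rights G"
  by auto

lemma inj_neg [simp]: "inj_on neg A"
  by (simp add: inj_on_def)

lemma height_neg [simp]: "height (neg G) = height G"
proof (induction G)
  case (Game L R)
  then have "height |`| neg |`| L = height |`| L" "height |`| neg |`| R = height |`| R"
    by (auto simp: fset.map_comp o_def cong: fset.map_cong)
  then show ?case by (simp add: Un_commute)
qed

lemma size_neg [simp]: "size (neg G) = size G"
  by (induction G) (simp add: sum.reindex)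

lemma neg_le_iff [simp]: "neg G \<preceq> neg H \<longleftrightarrow> H \<preceq> G"
proof (induction "height G + height H" arbitrary: G H rule: less_induct)
  case less
  have "X |\<in>| rights G \<Longrightarrow> neg H \<preceq> neg X \<longleftrightarrow> X \<preceq> H" for X
    by (rule less) simp
  moreover have "X |\<in>| lefts H \<Longrightarrow> neg X \<preceq> neg G \<longleftrightarrow> G \<preceq> X" for X
    by (rule less) simp
  ultimately show ?case
    by (subst (1 2) game_le.simps) auto
qed

lemma neg_game_eq_iff [simp]: "neg G \<approx> neg H \<longleftrightarrow> G \<approx> H"
  by (auto simp: game_eq_def)

lemma neg_plus: "neg (G \<oplus> H) = neg G \<oplus> neg H"
proof (induction "height G + height H" arbitrary: G H rule: less_induct)
  case less
  have 1: "neg (X \<oplus> H) = neg X \<oplus> neg H" if "X |\<in>| lefts G |\<union>| rights G" for X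
    using that by (intro less) (simp add: height_option_less)
  have 2: "neg (G \<oplus> X) = neg G \<oplus> neg X" if "X |\<in>| lefts H |\<union>| rights H" for X
    using that by (intro less) (simp add: height_option_less)
  show ?case
    by (rule game.expand)
      (subst (1 2 3 4) game_plus.simps, simp add: fimage_funion fset.map_comp o_def 1 2 cong: fset.map_cong)
qed

section \<open>Canonical forms\<close>

lemma size_left: "X |\<in>| lefts G \<Longrightarrow> size G = Suc (size X) + size (Game (lefts G |-| {|X|}) (rights G))"
  by (cases G) (simp add: sum.remove)

lemma size_union_lefts: "size (Game (L |\<union>| L') R) < size (Game L R) + size (Game L' R')"
proof -
  have "sum f (fset L \<union> fset L') \<le> sum f (fset L) + sum f (fset L')" for f :: "game \<Rightarrow> nat"
    by (metis sum.union_inter finite_fset le_add1)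
  from this[of "\<lambda>X. Suc (size X)"] show ?thesis by (simp add: add_mono)
qed

text \<open>The common pattern of all simplifications on the left: shared right options cannot
  refute either comparison, as none lies below its own game.\<close>

lemma game_eq_leftsI:
  assumes "rights K = rights G"
    and "\<And>X. X |\<in>| lefts K \<Longrightarrow> \<not> G \<preceq> X" "\<And>X. X |\<in>| lefts G \<Longrightarrow> \<not> K \<preceq> X"
  shows "K \<approx> G"
  unfolding game_eq_def
  using assms not_own_right_le[of _ K] not_own_right_le[of _ G] by (auto intro!: game_leI)

text \<open>Canonical forms will be the games of least size in their class. Size is chosen over
  height because it counts every option, so that deleting a dominated option strictly lowers it,
  while the height may stay the same.\<close>

definition size_minimal :: "game \<Rightarrow> bool" where
  "size_minimal G \<longleftrightarrow> (\<forall>H. H \<approx> G \<longrightarrow> size G \<le> size H)"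

lemma size_minimal_neg: "size_minimal G \<Longrightarrow> size_minimal (neg G)"
  unfolding size_minimal_def by (metis neg_game_eq_iff neg_neg size_neg)

lemma size_minimal_left:
  assumes "size_minimal G" "X |\<in>| lefts G"
  shows "size_minimal X"
  unfolding size_minimal_def
proof (intro allI impI)
  fix Y assume "Y \<approx> X"
  then have Y: "Y \<preceq> X" "X \<preceq> Y" by (auto simp: game_eq_def)
  let ?L = "lefts G |-| {|X|}"
  \<comment> \<open>Trading the option X for the equal game Y preserves the value, so a smaller Y
    would give a game smaller than G.\<close>
  let ?K = "Game (?L |\<union>| {|Y|}) (rights G)"
  have "\<not> G \<preceq> Y" using Y assms(2) not_le_own_left game_le_trans by blast
  moreover have "\<not> ?K \<preceq> X" using Y not_le_own_left[of Y ?K] game_le_trans[of ?K X Y] by auto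
  ultimately have "?K \<approx> G"
    using not_le_own_left[of _ ?K] not_le_own_left[of _ G] by (intro game_eq_leftsI) auto
  then have "size G \<le> size ?K" using assms(1) unfolding size_minimal_def by blast
  then show "size X \<le> size Y"
    using size_left[OF assms(2)] size_union_lefts[of ?L "{|Y|}" "rights G" "{||}"] by simp
qed

lemma size_minimal_right: "size_minimal G \<Longrightarrow> X |\<in>| rights G \<Longrightarrow> size_minimal X"
  using size_minimal_left[OF size_minimal_neg, of G "neg X"] size_minimal_neg[of "neg X"] by auto

lemma size_minimal_subposition: "subposition H G \<Longrightarrow> size_minimal G \<Longrightarrow> size_minimal H"
  by (induction rule: subposition.induct) (auto intro: size_minimal_left size_minimal_right)

lemma size_minimal_left_not_dominated:
  assumes "size_minimal G" "X |\<in>| lefts G" "Y |\<in>| lefts G" "X \<noteq> Y"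
  shows "\<not> X \<preceq> Y"
proof
  assume le: "X \<preceq> Y"
  let ?K = "Game (lefts G |-| {|X|}) (rights G)"
  have "\<not> ?K \<preceq> X"
    using assms(3,4) le not_le_own_left[of Y ?K] game_le_trans[of ?K X Y] by auto
  then have "?K \<approx> G"
    using not_le_own_left[of _ ?K] not_le_own_left[of _ G] by (intro game_eq_leftsI) auto
  then have "size G \<le> size ?K" using assms(1) unfolding size_minimal_def by blast
  then show False using size_left[OF assms(2)] by simp
qed

lemma size_minimal_left_not_reversible:
  assumes "size_minimal G" "X |\<in>| lefts G" "Z |\<in>| rights X"
  shows "\<not> Z \<preceq> G"
proof
  assume le: "Z \<preceq> G"
  let ?L = "lefts G |-| {|X|}"
  let ?K = "Game (?L |\<union>| lefts Z) (rights G)"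
  \<comment> \<open>The reversing option stays below the bypassed game: its left options are now
    options of \<open>?K\<close>, and a right option of G below Z would lie below G. Since Z is a
    right option of X, this excludes \<open>?K \<preceq> X\<close>.\<close>
  have "Z \<preceq> ?K"
    using not_le_own_left[of _ ?K] not_own_right_le[of _ G] game_le_trans[OF _ le]
    by (intro game_leI) auto
  then have "\<not> ?K \<preceq> X" using assms(3) not_right_le by blast
  moreover have "\<not> G \<preceq> W" if "W |\<in>| lefts Z" for W
    using that le not_le_own_left game_le_trans by blast
  ultimately have "?K \<approx> G"
    using not_le_own_left[of _ ?K] not_le_own_left[of _ G] by (intro game_eq_leftsI) auto
  then have "size G \<le> size ?K" using assms(1) unfolding size_minimal_def by blast
  \<comment> \<open>Bypassing pays off: the left options of Z together weigh less than Z, and Z less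
    than the deleted X.\<close>
  moreover have "size Z < size X"
    using size_left[of "neg Z" "neg X"] assms(3) by simp
  ultimately show False
    using size_left[OF assms(2)] size_union_lefts[of ?L "lefts Z" "rights G" "rights Z"] by simp
qed

lemma size_minimal_canonical:
  assumes "size_minimal G"
  shows "canonical G"
  unfolding canonical_def
proof (intro allI impI)
  fix H assume "subposition H G"
  with assms have H: "size_minimal H" by (simp add: size_minimal_subposition)
  note N = size_minimal_neg[OF H]
  have "\<not> Y \<preceq> X" if "X |\<in>| rights H" "Y |\<in>| rights H" "X \<noteq> Y" for X Y
    using size_minimal_left_not_dominated[OF N, of "neg X" "neg Y"] that by simp
  moreover have "\<not> H \<preceq> Z" if "X |\<in>| rights H" "Z |\<in>| lefts X" for X Z
    using size_minimal_left_not_reversible[OF N, of "neg X" "neg Z"] that by simp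
  ultimately show "\<not> has_dominated_option H \<and> \<not> has_reversible_option H"
    unfolding has_dominated_option_def has_reversible_option_def
    using size_minimal_left_not_dominated[OF H] size_minimal_left_not_reversible[OF H] by blast
qed

lemma canonical_exists: "\<exists>K. canonical K \<and> K \<approx> G"
proof -
  obtain K where K: "K \<approx> G" "\<And>H. H \<approx> G \<Longrightarrow> size K \<le> size H"
    using ex_has_least_nat[of "\<lambda>K. K \<approx> G" G size] by auto
  then have "size_minimal K"
    unfolding size_minimal_def using game_eq_trans by blast
  then show ?thesis using K size_minimal_canonical by blast
qed

section \<open>Uniqueness of canonical forms\<close>

lemma canonical_left: "canonical G \<Longrightarrow> X |\<in>| lefts G \<Longrightarrow> canonical X"
  and canonical_right: "canonical G \<Longrightarrow> X |\<in>| rights G \<Longrightarrow> canonical X"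
  unfolding canonical_def using subposition_left subposition_right by blast+

text \<open>A left option X of one game lies below a left option of the other, since otherwise X
  would be reversible. Going there and back gives an option that dominates X, hence X itself. So
  options match up to equality of values, and induction makes them identical.\<close>

lemma canonical_unique: "canonical G \<Longrightarrow> canonical H \<Longrightarrow> G \<approx> H \<Longrightarrow> G = H"
proof (induction "height G" arbitrary: G H rule: less_induct)
  case less
  have no: "\<not> has_dominated_option K \<and> \<not> has_reversible_option K" if "canonical K" for K
    using that subposition_refl canonical_def by blast
  have L: "\<exists>Y. Y |\<in>| lefts B \<and> X \<preceq> Y" if "X |\<in>| lefts A" "canonical A" "A \<approx> B" for A B X
  proof -
    have "\<not> B \<preceq> X" using that not_le_left by (auto simp: game_eq_def)
    then show ?thesis
    proof (cases rule: not_game_leE)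
      case (2 Z)
      then have "Z \<preceq> A" using that game_le_trans by (auto simp: game_eq_def)
      then show ?thesis using 2 that no by (auto simp: has_reversible_option_def)
    qed blast
  qed
  have R: "\<exists>Y. Y |\<in>| rights B \<and> Y \<preceq> X" if "X |\<in>| rights A" "canonical A" "A \<approx> B" for A B X
  proof -
    have "\<not> X \<preceq> B" using that not_right_le by (auto simp: game_eq_def)
    then show ?thesis
    proof (cases rule: not_game_leE)
      case (1 Z)
      then have "A \<preceq> Z" using that game_le_trans by (auto simp: game_eq_def)
      then show ?thesis using 1 that no by (auto simp: has_reversible_option_def)
    qed blast
  qed
  have L': "\<exists>Y. Y |\<in>| lefts B \<and> X \<approx> Y" if *: "X |\<in>| lefts A" "canonical A" "canonical B" "A \<approx> B" for A B X
  proof -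
    obtain Y where Y: "Y |\<in>| lefts B" "X \<preceq> Y" using L[OF *(1,2,4)] by blast
    obtain X' where X': "X' |\<in>| lefts A" "Y \<preceq> X'" using L[OF Y(1) *(3) game_eq_sym[OF *(4)]] by blast
    have "X' = X"
      using no[OF *(2)] X'(1) *(1) game_le_trans[OF Y(2) X'(2)]
      unfolding has_dominated_option_def by blast
    then show ?thesis using Y X' by (auto simp: game_eq_def)
  qed
  have R': "\<exists>Y. Y |\<in>| rights B \<and> X \<approx> Y" if *: "X |\<in>| rights A" "canonical A" "canonical B" "A \<approx> B" for A B X
  proof -
    obtain Y where Y: "Y |\<in>| rights B" "Y \<preceq> X" using R[OF *(1,2,4)] by blast
    obtain X' where X': "X' |\<in>| rights A" "X' \<preceq> Y" using R[OF Y(1) *(3) game_eq_sym[OF *(4)]] by blast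
    have "X' = X"
      using no[OF *(2)] X'(1) *(1) game_le_trans[OF X'(2) Y(2)]
      unfolding has_dominated_option_def by blast
    then show ?thesis using Y X' by (auto simp: game_eq_def)
  qed
  note c = \<open>canonical G\<close> \<open>canonical H\<close> \<open>G \<approx> H\<close> game_eq_sym[OF \<open>G \<approx> H\<close>]
  have eqL: "X = Y" if "X |\<in>| lefts G" "Y |\<in>| lefts H" "X \<approx> Y" for X Y
    using that c by (intro less.hyps) (auto intro: canonical_left)
  have eqR: "X = Y" if "X |\<in>| rights G" "Y |\<in>| rights H" "X \<approx> Y" for X Y
    using that c by (intro less.hyps) (auto intro: canonical_right)
  have "lefts G = lefts H"
    using L'[of _ G H] L'[of _ H G] c eqL game_eq_sym by (metis fset_eqI)
  moreover have "rights G = rights H"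
    using R'[of _ G H] R'[of _ H G] c eqR game_eq_sym by (metis fset_eqI)
  ultimately show ?case by (rule game.expand[OF conjI])
qed

lemma canonical_form: "canonical (canonical_form G)" "canonical_form G \<approx> G"
proof -
  have "\<exists>!K. canonical K \<and> K \<approx> G"
    using canonical_exists canonical_unique game_eq_sym game_eq_trans by meson
  then show "canonical (canonical_form G)" "canonical_form G \<approx> G"
    unfolding canonical_form_def by (metis (mono_tags, lifting) theI')+
qed

lemma birthday_eq_height: "canonical K \<Longrightarrow> G \<approx> K \<Longrightarrow> birthday G = height K"
  unfolding birthday_def
  using canonical_form canonical_unique game_eq_trans by metis

section \<open>Dyadic rationals\<close>

lemma neg_nat_game [simp]: "neg (nat_game k) = neg_nat_game k"
  by (induction k) auto

lemma neg_dyadic_game [simp]: "neg (dyadic_game m n) = dyadic_game (- m) n"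
proof (induction m n rule: dyadic_game.induct)
  case (1 m)
  have "neg (neg_nat_game k) = nat_game k" for k
    by (metis neg_nat_game neg_neg)
  then show ?case by (cases "m = 0") auto
next
  case (2 m n)
  show ?case
  proof (cases "even m")
    case True
    then obtain k where "m = 2 * k" by (elim evenE)
    moreover from this have "- m div 2 = - k" by simp
    ultimately show ?thesis using 2 by simp
  next
    case False
    then obtain k where "m = 2 * k + 1" by (elim oddE)
    moreover from this have "(- m - 1) div 2 = - ((m + 1) div 2)" "(- m + 1) div 2 = - ((m - 1) div 2)"
      by auto
    ultimately show ?thesis using 2 False by simp
  qed
qed

text \<open>An identity of trees, not merely of values, because the recursion halves even
  numerators. It allows passing to common denominators for free.\<close>

lemma dyadic_game_scale: "dyadic_game (m * 2 ^ k) (n + k) = dyadic_game m n"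
proof (induction k)
  case (Suc k)
  have "dyadic_game (m * 2 ^ Suc k) (n + Suc k) = dyadic_game (m * 2 ^ k) (n + k)"
    by simp
  with Suc show ?case by simp
qed simp

text \<open>Options are written over the denominator of the game itself, so that later inductions
  compare integer numerators at a fixed n.\<close>

lemma lefts_dyadic_game: "X |\<in>| lefts (dyadic_game m n) \<Longrightarrow> \<exists>m'<m. X = dyadic_game m' n"
proof (induction n arbitrary: m X)
  case 0
  then have "m > 0"
    by (cases "nat (- m)"; cases "m = 0") (auto split: if_splits)
  then obtain k where "m = int (Suc k)"
    using zero_less_imp_eq_int[of m] by (metis Suc_pred)
  moreover from this have "nat m = Suc k" by simp
  ultimately have "X = dyadic_game (int k) 0" using 0 by simp
  then show ?case using \<open>m = int (Suc k)\<close> by (intro exI[of _ "int k"]) simp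
next
  case (Suc n)
  show ?case
  proof (cases "even m")
    case True
    with Suc.prems have "X |\<in>| lefts (dyadic_game (m div 2) n)" by simp
    with Suc.IH obtain m' where "m' < m div 2" "X = dyadic_game m' n" by blast
    then have "X = dyadic_game (2 * m') (Suc n)" "2 * m' < m" by auto
    then show ?thesis by blast
  next
    case False
    then have "X = dyadic_game (m - 1) (Suc n)" using Suc.prems by simp
    then show ?thesis by (intro exI[of _ "m - 1"]) simp
  qed
qed

lemma rights_dyadic_game:
  assumes "X |\<in>| rights (dyadic_game m n)"
  shows "\<exists>m'>m. X = dyadic_game m' n"
proof -
  have "neg X |\<in>| lefts (neg (dyadic_game m n))" unfolding neg_mem_lefts_neg by fact
  then obtain m' where "m' < - m" "neg X = dyadic_game m' n"
    using lefts_dyadic_game by (metis neg_dyadic_game)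
  then have "X = dyadic_game (- m') n" "- m' > m" by (metis neg_neg neg_dyadic_game, simp)
  then show ?thesis by blast
qed

lemma dyadic_game_left_option:
  assumes "if n = 0 then m > 0 else odd m"
  shows "dyadic_game (m - 1) n |\<in>| lefts (dyadic_game m n)"
proof (cases n)
  case 0
  then obtain k where "m = int (Suc k)"
    using zero_less_imp_eq_int[of m] assms by (metis Suc_pred)
  moreover from this have "nat m = Suc k" by simp
  ultimately show ?thesis using 0 by simp
next
  case (Suc k)
  with assms show ?thesis by simp
qed

lemma dyadic_game_right_option:
  assumes "if n = 0 then m < 0 else odd m"
  shows "dyadic_game (m + 1) n |\<in>| rights (dyadic_game m n)"
proof -
  have "neg (dyadic_game (m + 1) n) |\<in>| lefts (neg (dyadic_game m n))"
    using dyadic_game_left_option[of n "- m"] assms by (simp split: if_splits)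
  then show ?thesis unfolding neg_mem_lefts_neg .
qed

section \<open>Order and sums of dyadic rationals\<close>

text \<open>The summand n in the measure serves the case of two even numerators: halving them leaves
  both trees, hence the heights, unchanged and lowers only n.\<close>

lemma dyadic_game_le_iff: "dyadic_game p n \<preceq> dyadic_game q n \<longleftrightarrow> p \<le> q"
proof (induction "height (dyadic_game p n) + height (dyadic_game q n) + n" arbitrary: p q n rule: less_induct)
  case less
  show ?case
  proof
    assume "p \<le> q"
    show "dyadic_game p n \<preceq> dyadic_game q n"
    proof (rule game_leI)
      fix X assume X: "X |\<in>| lefts (dyadic_game p n)"
      then obtain m where m: "m < p" "X = dyadic_game m n" using lefts_dyadic_game by blast
      with X less[of q n m] \<open>p \<le> q\<close> show "\<not> dyadic_game q n \<preceq> X" by simp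
    next
      fix X assume X: "X |\<in>| rights (dyadic_game q n)"
      then obtain m where m: "m > q" "X = dyadic_game m n" using rights_dyadic_game by blast
      with X less[of m n p] \<open>p \<le> q\<close> show "\<not> X \<preceq> dyadic_game p n" by simp
    qed
  next
    assume le: "dyadic_game p n \<preceq> dyadic_game q n"
    show "p \<le> q"
    proof (rule ccontr)
      assume "\<not> p \<le> q"
      \<comment> \<open>If p > q, then p has the left option p - 1, still at least q, or q has the
        right option q + 1, still at most p, or both fractions can be halved. For n = 0, one of p >
        0 and q < 0 must hold.\<close>
      then consider "if n = 0 then p > 0 else odd p" | "if n = 0 then q < 0 else odd q"
        | k where "n = Suc k" "even p" "even q"
        by (cases n; cases "p > 0"; auto)
      then show False
      proof cases
        case 1
        then have left: "dyadic_game (p - 1) n |\<in>| lefts (dyadic_game p n)"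
          by (rule dyadic_game_left_option)
        then show False
          using less[of q n "p - 1"] not_le_left[OF le] \<open>\<not> p \<le> q\<close> by simp
      next
        case 2
        then have right: "dyadic_game (q + 1) n |\<in>| rights (dyadic_game q n)"
          by (rule dyadic_game_right_option)
        then show False
          using less[of "q + 1" n p] not_right_le[OF le] \<open>\<not> p \<le> q\<close> by simp
      next
        case 3
        then show False
          using less[of "p div 2" k "q div 2"] le \<open>\<not> p \<le> q\<close> by (auto elim!: evenE)
      qed
    qed
  qed
qed

lemma dyadic_game_plus_le: "dyadic_game p n \<oplus> dyadic_game q n \<preceq> dyadic_game (p + q) n"
proof (induction "height (dyadic_game p n) + height (dyadic_game q n) + n" arbitrary: p q n rule: less_induct)
  case less
  let ?P = "dyadic_game p n" and ?Q = "dyadic_game q n"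
  show ?case
  proof (rule game_leI)
    fix X assume "X |\<in>| lefts (?P \<oplus> ?Q)"
    then consider P where "P |\<in>| lefts ?P" "X = P \<oplus> ?Q" | Q where "Q |\<in>| lefts ?Q" "X = ?P \<oplus> Q"
      by (auto simp: lefts_plus)
    then obtain c where c: "X \<preceq> dyadic_game c n" "c < p + q"
    proof cases
      case 1
      then obtain m where m: "m < p" "P = dyadic_game m n" using lefts_dyadic_game by blast
      then have "X \<preceq> dyadic_game (m + q) n" using 1 less[of m n q] by simp
      with m that show ?thesis by simp
    next
      case 2
      then obtain m where m: "m < q" "Q = dyadic_game m n" using lefts_dyadic_game by blast
      then have "X \<preceq> dyadic_game (p + m) n" using 2 less[of p n m] by simp
      with m that show ?thesis by simp
    qed
    then show "\<not> dyadic_game (p + q) n \<preceq> X"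
      using game_le_trans[of _ X "dyadic_game c n"] dyadic_game_le_iff by fastforce
  next
    fix Z assume Z: "Z |\<in>| rights (dyadic_game (p + q) n)"
    then obtain c where c: "Z = dyadic_game c n" "c > p + q" using rights_dyadic_game by blast
    \<comment> \<open>An integer with a right option is negative, so one of the two summands is
      negative and has a right option as well.\<close>
    have "n = 0 \<Longrightarrow> p + q < 0"
      using Z by (cases "p + q \<ge> 0"; cases "nat (p + q)") auto
    then consider "if n = 0 then p < 0 else odd p" | "if n = 0 then q < 0 else odd q"
      | k where "n = Suc k" "even p" "even q"
      by (cases n; cases "p < 0"; auto)
    then show "\<not> Z \<preceq> ?P \<oplus> ?Q"
    proof cases
      case 1
      then have right: "dyadic_game (p + 1) n |\<in>| rights ?P"
        by (rule dyadic_game_right_option)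
      \<comment> \<open>Raising one numerator by 1 gives a right option of the sum that is at most
        Z, because c is at least p + q + 1.\<close>
      then have "dyadic_game (p + 1) n \<oplus> ?Q \<preceq> dyadic_game (p + 1 + q) n"
        using less[of "p + 1" n q] by simp
      moreover have "dyadic_game (p + 1 + q) n \<preceq> Z"
        using c by (simp add: dyadic_game_le_iff)
      moreover have "\<not> dyadic_game (p + 1) n \<oplus> ?Q \<preceq> ?P \<oplus> ?Q"
        using right by (simp add: not_own_right_le)
      ultimately show ?thesis using game_le_trans by blast
    next
      case 2
      then have right: "dyadic_game (q + 1) n |\<in>| rights ?Q"
        by (rule dyadic_game_right_option)
      then have "?P \<oplus> dyadic_game (q + 1) n \<preceq> dyadic_game (p + (q + 1)) n"
        using less[of p n "q + 1"] by simp
      moreover have "dyadic_game (p + (q + 1)) n \<preceq> Z"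
        using c by (simp add: dyadic_game_le_iff)
      moreover have "\<not> ?P \<oplus> dyadic_game (q + 1) n \<preceq> ?P \<oplus> ?Q"
        using right by (simp add: not_own_right_le)
      ultimately show ?thesis using game_le_trans by blast
    next
      case 3
      then have "?P \<oplus> ?Q \<preceq> dyadic_game (p + q) n"
        using less[of "p div 2" k "q div 2"] by (auto elim!: evenE simp flip: distrib_left)
      with Z show ?thesis using not_own_right_le game_le_trans by blast
    qed
  qed
qed

lemma dyadic_game_plus: "dyadic_game p n \<oplus> dyadic_game q n \<approx> dyadic_game (p + q) n"
proof -
  have "neg (dyadic_game p n \<oplus> dyadic_game q n) \<preceq> neg (dyadic_game (p + q) n)"
    using dyadic_game_plus_le[of "- p" n "- q"] by (simp add: neg_plus)
  then show ?thesis
    unfolding neg_le_iff game_eq_def using dyadic_game_plus_le by blast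
qed

section \<open>Canonicity and heights of dyadic rationals\<close>

lemma dyadic_game_left_unique:
  "X |\<in>| lefts (dyadic_game m n) \<Longrightarrow> Y |\<in>| lefts (dyadic_game m n) \<Longrightarrow> X = Y"
proof (induction n arbitrary: m)
  case 0
  then show ?case by (cases "m \<ge> 0"; cases "nat m"; cases "nat (- m)") auto
next
  case (Suc n)
  then show ?case by (cases "even m") auto
qed

text \<open>For odd m, right options of the left neighbour m - 1 have even numerators over the same
  denominator, so they start at m + 1 and pass beyond m.\<close>

lemma dyadic_game_left_not_reversible:
  "X |\<in>| lefts (dyadic_game m n) \<Longrightarrow> Z |\<in>| rights X \<Longrightarrow> \<not> Z \<preceq> dyadic_game m n"
proof (induction n arbitrary: m)
  case 0
  have "rights (nat_game k) = {||}" for k by (cases k) auto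
  with 0 show ?case by (cases "m \<ge> 0"; cases "nat m"; cases "nat (- m)") auto
next
  case (Suc n)
  show ?case
  proof (cases "even m")
    case True
    with Suc show ?thesis by simp
  next
    case False
    then have "X = dyadic_game ((m - 1) div 2) n" using Suc by simp
    then obtain c where c: "c > (m - 1) div 2" "Z = dyadic_game c n"
      using Suc.prems(2) rights_dyadic_game by blast
    then have "Z = dyadic_game (2 * c) (Suc n)" by simp
    moreover have "\<not> 2 * c \<le> m" using c False by presburger
    ultimately show ?thesis using dyadic_game_le_iff by blast
  qed
qed

lemma subposition_dyadic_game: "subposition H G \<Longrightarrow> G = dyadic_game m n \<Longrightarrow> \<exists>m'. H = dyadic_game m' n"
  by (induction arbitrary: m rule: subposition.induct)
    (use lefts_dyadic_game rights_dyadic_game in blast)+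

lemma canonical_dyadic_game: "canonical (dyadic_game m n)"
  unfolding canonical_def
proof (intro allI impI)
  fix H assume "subposition H (dyadic_game m n)"
  then obtain c where H: "H = dyadic_game c n" using subposition_dyadic_game by blast
  have N: "neg H = dyadic_game (- c) n" by (simp add: H)
  have "X = Y" if "X |\<in>| rights H" "Y |\<in>| rights H" for X Y
    using that dyadic_game_left_unique[of "neg X" "- c" n "neg Y"] neg_mem_lefts_neg[of _ H]
    by (simp add: N)
  moreover have "\<not> H \<preceq> Z" if "X |\<in>| rights H" "Z |\<in>| lefts X" for X Z
    using that dyadic_game_left_not_reversible[of "neg X" "- c" n "neg Z"] neg_mem_lefts_neg[of _ H]
    by (simp flip: N)
  ultimately show "\<not> has_dominated_option H \<and> \<not> has_reversible_option H"
    unfolding has_dominated_option_def has_reversible_option_def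
    using dyadic_game_left_unique dyadic_game_left_not_reversible H by blast
qed

lemma birthday_dyadic_game: "birthday (dyadic_game m n) = height (dyadic_game m n)"
  by (rule birthday_eq_height[OF canonical_dyadic_game game_eq_refl])

lemma birthday_cong: "G \<approx> H \<Longrightarrow> birthday G = birthday H"
  using birthday_eq_height canonical_form game_eq_sym game_eq_trans by metis

lemma height_nat_game [simp]: "height (nat_game k) = k"
  by (induction k) auto

lemma height_dyadic_game_uminus: "height (dyadic_game (- m) n) = height (dyadic_game m n)"
  by (metis height_neg neg_dyadic_game)

text \<open>Each binary digit costs at most one level. The interval enters because both neighbours
  of an odd numerator, halved, stay in the corresponding interval one denominator lower.\<close>

lemma height_dyadic_game_le: "\<bar>m\<bar> \<le> 2 ^ n \<Longrightarrow> height (dyadic_game m n) \<le> Suc n"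
proof (induction n arbitrary: m)
  case 0
  then have "m = 0 \<or> m = 1 \<or> m = - 1" by auto
  then show ?case using height_dyadic_game_uminus[of 1 0] by auto
next
  case (Suc n)
  show ?case
  proof (cases "even m")
    case True
    then have "\<bar>m div 2\<bar> \<le> 2 ^ n" using Suc.prems by auto
    with True Suc.IH show ?thesis by (simp add: le_SucI)
  next
    case False
    then obtain k where k: "m = 2 * k + 1" by (elim oddE)
    then have "\<bar>k\<bar> \<le> 2 ^ n" "\<bar>k + 1\<bar> \<le> 2 ^ n" using Suc.prems by auto
    with k Suc.IH[of k] Suc.IH[of "k + 1"] show ?thesis by (simp add: add.commute)
  qed
qed

text \<open>Adding 1 commutes with the recursion on the denominator, so the claim descends to
  integers. For negative numbers the shift would move towards 0 and could lower the height.\<close>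

lemma height_dyadic_game_add_one:
  "m \<ge> 0 \<Longrightarrow> height (dyadic_game (m + 2 ^ n) n) = Suc (height (dyadic_game m n))"
proof (induction n arbitrary: m)
  case 0
  then show ?case by (simp add: nat_add_distrib)
next
  case (Suc n)
  show ?case
  proof (cases "even m")
    case True
    then have "(m + 2 ^ Suc n) div 2 = m div 2 + 2 ^ n" by auto
    with True Suc show ?thesis by simp
  next
    case False
    then obtain k where k: "m = 2 * k + 1" by (elim oddE)
    then have "(m + 2 ^ Suc n - 1) div 2 = k + 2 ^ n" "(m + 2 ^ Suc n + 1) div 2 = k + 1 + 2 ^ n"
      "k \<ge> 0" using Suc.prems by auto
    moreover have "odd (m + 2 ^ Suc n)" using False by simp
    ultimately show ?thesis
      using k False Suc.IH[of k] Suc.IH[of "k + 1"] by (simp add: ac_simps del: power_Suc)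
  qed
qed

section \<open>Stops\<close>

lemma dyadic_common_denominator:
  obtains p q k where "of_int m / 2 ^ n = (of_int p / 2 ^ k :: rat)" "dyadic_game m n = dyadic_game p k"
    "of_int m' / 2 ^ n' = (of_int q / 2 ^ k :: rat)" "dyadic_game m' n' = dyadic_game q k"
proof (rule that[where p = "m * 2 ^ n'" and q = "m' * 2 ^ n" and k = "n + n'"])
  show "dyadic_game m n = dyadic_game (m * 2 ^ n') (n + n')" by (simp add: dyadic_game_scale)
  show "dyadic_game m' n' = dyadic_game (m' * 2 ^ n) (n + n')"
    using dyadic_game_scale[of m' n n'] by (simp add: add.commute)
qed (simp_all add: field_simps power_add)

lemma dyadic_game_le: "dyadic_game m n \<preceq> dyadic_game m' n' \<longleftrightarrow> (of_int m / 2 ^ n :: rat) \<le> of_int m' / 2 ^ n'"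
proof -
  obtain p q k where "of_int m / 2 ^ n = (of_int p / 2 ^ k :: rat)" "dyadic_game m n = dyadic_game p k"
    "of_int m' / 2 ^ n' = (of_int q / 2 ^ k :: rat)" "dyadic_game m' n' = dyadic_game q k"
    using dyadic_common_denominator by metis
  then show ?thesis by (simp add: dyadic_game_le_iff divide_le_cancel)
qed

section \<open>The simplicity theorem\<close>

text \<open>Simplicity is made lexicographic: exponent of the denominator first, then absolute
  numerator. This is the order minimised in \<open>simplest_number\<close>.\<close>

lemma dyadic_option_simpler:
  "X |\<in>| lefts (dyadic_game m n) |\<union>| rights (dyadic_game m n) \<Longrightarrow>
    \<exists>c j. X = dyadic_game c j \<and> (j < n \<or> j = n \<and> \<bar>c\<bar> < \<bar>m\<bar>)"
proof (induction n arbitrary: m)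
  case 0
  then consider "X |\<in>| lefts (dyadic_game m 0)" "m > 0" | "X |\<in>| rights (dyadic_game m 0)" "m < 0"
    by (cases "nat m"; cases "nat (- m)"; cases "m = 0"; auto split: if_splits)
  then show ?case
  proof cases
    case 1
    then have "X = dyadic_game (m - 1) 0"
      using dyadic_game_left_option[of 0 m] by (intro dyadic_game_left_unique[of _ m 0]) simp_all
    with 1 show ?thesis by (intro exI[of _ "m - 1"] exI[of _ 0]) simp
  next
    case 2
    then obtain k where "nat (- m) = Suc k" by (cases "nat (- m)") auto
    then have "X = dyadic_game (m + 1) 0"
      using 2 dyadic_game_right_option[of 0 m] by simp
    with 2 show ?thesis by (intro exI[of _ "m + 1"] exI[of _ 0]) simp
  qed
next
  case (Suc n)
  show ?case
  proof (cases "even m")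
    case True
    with Suc obtain c j where "X = dyadic_game c j" "j < n \<or> j = n \<and> \<bar>c\<bar> < \<bar>m div 2\<bar>"
      by fastforce
    then show ?thesis by (intro exI[of _ c] exI[of _ j]) auto
  next
    case False
    with Suc.prems show ?thesis by auto
  qed
qed

text \<open>Conway's simplicity theorem for arbitrary options of H: if some number fits between
  them, H equals the simplest fitting one. The bound on the exponent is what keeps stops in a fixed
  grid.\<close>

lemma simplest_number:
  assumes "\<And>X. X |\<in>| lefts H \<Longrightarrow> \<not> dyadic_game m n \<preceq> X"
    and "\<And>Y. Y |\<in>| rights H \<Longrightarrow> \<not> Y \<preceq> dyadic_game m n"
  shows "\<exists>m' k. k \<le> n \<and> H \<approx> dyadic_game m' k"
proof -
  define P where "P m n \<longleftrightarrow> (\<forall>X. X |\<in>| lefts H \<longrightarrow> \<not> dyadic_game m n \<preceq> X) \<and>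
    (\<forall>Y. Y |\<in>| rights H \<longrightarrow> \<not> Y \<preceq> dyadic_game m n)" for m n
  have "P m n" using assms by (simp add: P_def)
  define k where "k = (LEAST k. \<exists>m. P m k)"
  have ex: "\<exists>m. P m k" unfolding k_def by (rule LeastI[of _ n]) (use \<open>P m n\<close> in blast)
  have k: "k \<le> n" "\<And>j c. P c j \<Longrightarrow> k \<le> j"
    unfolding k_def using \<open>P m n\<close> by (blast intro: Least_le)+
  obtain m' where m': "P m' k" "\<And>c. P c k \<Longrightarrow> nat \<bar>m'\<bar> \<le> nat \<bar>c\<bar>"
    using ex ex_has_least_nat[of "\<lambda>m. P m k" _ "\<lambda>m. nat \<bar>m\<bar>"] by metis
  let ?N = "dyadic_game m' k"
  \<comment> \<open>Every option of the minimal number is simpler than it, hence does not fit, and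
    some option of H witnesses this.\<close>
  have opt: "(\<exists>X. X |\<in>| lefts H \<and> Z \<preceq> X) \<or> (\<exists>Y. Y |\<in>| rights H \<and> Y \<preceq> Z)"
    if Z: "Z |\<in>| lefts ?N |\<union>| rights ?N" for Z
  proof -
    obtain c j where cj: "Z = dyadic_game c j" "j < k \<or> j = k \<and> \<bar>c\<bar> < \<bar>m'\<bar>"
      using dyadic_option_simpler[OF Z] by blast
    then have "\<not> P c j" using k(2)[of c j] m'(2)[of c] by auto
    then show ?thesis using cj by (auto simp: P_def)
  qed
  have "H \<preceq> ?N"
  proof (rule game_leI)
    fix X assume "X |\<in>| lefts H"
    then show "\<not> ?N \<preceq> X" using m'(1) by (simp add: P_def)
  next
    fix Z assume Z: "Z |\<in>| rights ?N"
    then have "?N \<preceq> Z" using rights_dyadic_game[OF Z] by (auto simp: dyadic_game_le_iff)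
    \<comment> \<open>Of the two witnesses for Z, a left option X of H above Z is impossible, as it
      would lie above \<open>?N\<close>, which fits.\<close>
    then have "\<not> Z \<preceq> X" if "X |\<in>| lefts H" for X
      using m'(1) that game_le_trans by (auto simp: P_def)
    then obtain Y where "Y |\<in>| rights H" "Y \<preceq> Z" using opt[of Z] Z by auto
    then show "\<not> Z \<preceq> H" using not_own_right_le game_le_trans by blast
  qed
  moreover have "?N \<preceq> H"
  proof (rule game_leI)
    fix X assume "X |\<in>| rights H"
    then show "\<not> X \<preceq> ?N" using m'(1) by (simp add: P_def)
  next
    fix Z assume Z: "Z |\<in>| lefts ?N"
    then have "Z \<preceq> ?N" using lefts_dyadic_game[OF Z] by (auto simp: dyadic_game_le_iff)
    then have "\<not> X \<preceq> Z" if "X |\<in>| rights H" for X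
      using m'(1) that game_le_trans by (auto simp: P_def)
    then obtain Y where "Y |\<in>| lefts H" "Z \<preceq> Y" using opt[of Z] Z by auto
    then show "\<not> H \<preceq> Z" using not_le_own_left game_le_trans by blast
  qed
  ultimately show ?thesis using k(1) by (auto simp: game_eq_def)
qed

section \<open>Stops and their recursion\<close>

text \<open>Nothing is demanded at l itself, where the comparison may turn on an
  infinitesimal.\<close>

definition left_stop :: "game \<Rightarrow> rat \<Rightarrow> bool" where
  "left_stop H l \<longleftrightarrow> (\<forall>m n. (l < of_int m / 2 ^ n \<longrightarrow> H \<preceq> dyadic_game m n) \<and>
     (of_int m / 2 ^ n < l \<longrightarrow> \<not> H \<preceq> dyadic_game m n))"

definition right_stop :: "game \<Rightarrow> rat \<Rightarrow> bool" where
  "right_stop H r \<longleftrightarrow> (\<forall>m n. (of_int m / 2 ^ n < r \<longrightarrow> dyadic_game m n \<preceq> H) \<and>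
     (r < of_int m / 2 ^ n \<longrightarrow> \<not> dyadic_game m n \<preceq> H))"

lemma left_stop_neg: "left_stop (neg H) (- r) \<longleftrightarrow> right_stop H r"
proof -
  have le: "neg H \<preceq> dyadic_game m n \<longleftrightarrow> dyadic_game (- m) n \<preceq> H" for m n
    by (metis neg_dyadic_game neg_le_iff neg_neg)
  have "(\<forall>m. Q m) \<longleftrightarrow> (\<forall>m. Q (- m))" for Q :: "int \<Rightarrow> bool"
    by (metis minus_minus)
  from this[of "\<lambda>m. \<forall>n. (of_int m / 2 ^ n < r \<longrightarrow> dyadic_game m n \<preceq> H) \<and>
     (r < of_int m / 2 ^ n \<longrightarrow> \<not> dyadic_game m n \<preceq> H)"]
  show ?thesis
    unfolding left_stop_def right_stop_def le by (simp add: minus_less_iff less_minus_iff)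
qed

lemma right_stop_neg: "right_stop (neg H) (- r) \<longleftrightarrow> left_stop H r"
  using left_stop_neg[of "neg H" "- r"] by simp

lemma stops_dyadic:
  assumes "H \<approx> dyadic_game m n"
  shows "left_stop H (of_int m / 2 ^ n)" "right_stop H (of_int m / 2 ^ n)"
proof -
  have "H \<preceq> K \<longleftrightarrow> dyadic_game m n \<preceq> K" "K \<preceq> H \<longleftrightarrow> K \<preceq> dyadic_game m n" for K
    using assms game_le_trans unfolding game_eq_def by blast+
  then show "left_stop H (of_int m / 2 ^ n)" "right_stop H (of_int m / 2 ^ n)"
    by (simp_all add: left_stop_def right_stop_def dyadic_game_le)
qed

text \<open>The usual recursion: a is the largest right stop among the left options. The condition
  \<open>b \<le> a\<close> marks the case where stops are inherited from options; equality is
  allowed.\<close>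

lemma left_stop_hot:
  assumes X: "X |\<in>| lefts H" "right_stop X a"
    and le: "\<And>X. X |\<in>| lefts H \<Longrightarrow> \<exists>r\<le>a. right_stop X r"
    and Y: "Y |\<in>| rights H" "left_stop Y b" and "b \<le> a"
  shows "left_stop H a"
  unfolding left_stop_def
proof (intro allI conjI impI)
  fix m n assume lt: "a < of_int m / 2 ^ n"
  show "H \<preceq> dyadic_game m n"
  proof (rule game_leI)
    fix X assume "X |\<in>| lefts H"
    then obtain r where "r \<le> a" "right_stop X r" using le by blast
    with lt show "\<not> dyadic_game m n \<preceq> X" unfolding right_stop_def by fastforce
  next
    \<comment> \<open>A weak form of number avoidance: a move to Z in the number is met by Y, since
      \<open>b \<le> a\<close> and a < c give \<open>Y \<preceq> Z\<close>, while Y is not below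
      H.\<close>
    fix Z assume "Z |\<in>| rights (dyadic_game m n)"
    then obtain c where c: "c > m" "Z = dyadic_game c n" using rights_dyadic_game by blast
    then have "(of_int m :: rat) / 2 ^ n < of_int c / 2 ^ n" by (simp add: divide_strict_right_mono)
    with lt \<open>b \<le> a\<close> have "b < of_int c / 2 ^ n" by linarith
    with Y c have "Y \<preceq> Z" by (simp add: left_stop_def)
    with Y show "\<not> Z \<preceq> H" using not_own_right_le game_le_trans by blast
  qed
next
  fix m n assume "of_int m / 2 ^ n < a"
  with X have "dyadic_game m n \<preceq> X" by (simp add: right_stop_def)
  with X show "\<not> H \<preceq> dyadic_game m n" using not_le_own_left game_le_trans by blast
qed

lemma right_stop_hot:
  assumes "Y |\<in>| rights H" "left_stop Y b"
    and "\<And>Y. Y |\<in>| rights H \<Longrightarrow> \<exists>l\<ge>b. left_stop Y l"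
    and "X |\<in>| lefts H" "right_stop X a" and "b \<le> a"
  shows "right_stop H b"
proof -
  have "left_stop (neg H) (- b)"
  proof (rule left_stop_hot[of "neg Y" _ _ "neg X" "- a"])
    fix Z assume "Z |\<in>| lefts (neg H)"
    then obtain W where "W |\<in>| rights H" "Z = neg W" by auto
    then show "\<exists>r\<le>- b. right_stop Z r"
      using assms(3)[of W] right_stop_neg[of W] by (metis neg_le_iff_le)
  qed (use assms in \<open>auto simp: left_stop_neg right_stop_neg\<close>)
  then show ?thesis by (simp add: left_stop_neg)
qed

section \<open>The grid of possible stops\<close>

text \<open>Indexed by height. The exponent lags one behind the height, and this lag yields the
  parity contradiction; at height 0 only the zero game exists.\<close>

fun stop_grid :: "nat \<Rightarrow> rat set" where
  "stop_grid 0 = {0}"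
| "stop_grid (Suc n) = range (\<lambda>a. of_int a / 2 ^ n)"

lemma stop_grid_Suc: "stop_grid n \<subseteq> stop_grid (Suc n)"
proof (cases n)
  case 0
  then show ?thesis by (auto intro: range_eqI[of _ _ 0])
next
  case (Suc k)
  have "of_int a / 2 ^ k = (of_int (2 * a) / 2 ^ Suc k :: rat)" for a by simp
  then show ?thesis unfolding Suc stop_grid.simps by blast
qed

lemma stop_grid_mono: "m \<le> n \<Longrightarrow> stop_grid m \<subseteq> stop_grid n"
  by (induction rule: dec_induct) (use stop_grid_Suc in blast)+

lemma stop_grid_succ: "a \<in> stop_grid n \<Longrightarrow> a + 1 \<in> stop_grid (Suc n)"
  and stop_grid_pred: "a \<in> stop_grid n \<Longrightarrow> a - 1 \<in> stop_grid (Suc n)"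
proof -
  assume "a \<in> stop_grid n"
  then obtain m where m: "a = of_int m / 2 ^ n" using stop_grid_Suc by fastforce
  have "a + 1 = of_int (m + 2 ^ n) / 2 ^ n" "a - 1 = of_int (m - 2 ^ n) / 2 ^ n"
    by (simp_all add: m field_simps)
  then show "a + 1 \<in> stop_grid (Suc n)" "a - 1 \<in> stop_grid (Suc n)"
    unfolding stop_grid.simps by blast+
qed

lemma stop_grid_midpoint:
  assumes "a \<in> stop_grid n" "b \<in> stop_grid n" "a < b"
  shows "(a + b) / 2 \<in> stop_grid (Suc n)"
proof (cases n)
  case 0
  with assms show ?thesis by simp
next
  case (Suc k)
  with assms obtain p q where "a = of_int p / 2 ^ k" "b = of_int q / 2 ^ k" by auto
  then have "(a + b) / 2 = of_int (p + q) / 2 ^ n" by (simp add: Suc field_simps)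
  then show ?thesis unfolding stop_grid.simps by blast
qed

text \<open>A midpoint, or a step of 1 beyond the extreme value if one side is empty, costs only one
  refinement of the grid.\<close>

lemma stop_grid_between:
  assumes "finite A" "finite B" "A \<subseteq> stop_grid n" "B \<subseteq> stop_grid n"
    and lt: "\<And>a b. a \<in> A \<Longrightarrow> b \<in> B \<Longrightarrow> a < b"
  shows "\<exists>c\<in>stop_grid (Suc n). (\<forall>a\<in>A. a < c) \<and> (\<forall>b\<in>B. c < b)"
proof -
  have A: "Max A \<in> stop_grid n" "\<forall>a\<in>A. a \<le> Max A" "Max A \<in> A" if "A \<noteq> {}"
    using assms(1,3) Max_in[OF assms(1) that] by auto
  have B: "Min B \<in> stop_grid n" "\<forall>b\<in>B. Min B \<le> b" "Min B \<in> B" if "B \<noteq> {}"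
    using assms(2,4) Min_in[OF assms(2) that] by auto
  consider "A = {}" "B = {}" | "A \<noteq> {}" "B = {}" | "A = {}" "B \<noteq> {}" | "A \<noteq> {}" "B \<noteq> {}" by blast
  then show ?thesis
  proof cases
    case 1
    then show ?thesis by auto
  next
    case 2
    then show ?thesis using A by (intro bexI[OF _ stop_grid_succ[of "Max A"]]) force+
  next
    case 3
    then show ?thesis using B by (intro bexI[OF _ stop_grid_pred[of "Min B"]]) force+
  next
    case 4
    then have "Max A < Min B" using A B lt by blast
    then show ?thesis
      using A B 4 by (intro bexI[OF _ stop_grid_midpoint[of "Max A" _ "Min B"]]) force+
  qed
qed

lemma stops_exist: "\<exists>l\<in>stop_grid (height H). \<exists>r\<in>stop_grid (height H). left_stop H l \<and> right_stop H r"
proof (induction "height H" arbitrary: H rule: less_induct)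
  case less
  then obtain ls rs where
    ls: "\<And>X. height X < height H \<Longrightarrow> ls X \<in> stop_grid (height X) \<and> left_stop X (ls X)" and
    rs: "\<And>X. height X < height H \<Longrightarrow> rs X \<in> stop_grid (height X) \<and> right_stop X (rs X)"
    by metis
  let ?A = "rs ` fset (lefts H)" and ?B = "ls ` fset (rights H)"
  have grid: "stop_grid (height X) \<subseteq> stop_grid (height H - 1)" if "height X < height H" for X
    using that by (intro stop_grid_mono) simp
  have A: "a \<in> stop_grid (height H - 1)" if "a \<in> ?A" for a
    using that rs grid by (auto dest!: height_left_less)
  have B: "b \<in> stop_grid (height H - 1)" if "b \<in> ?B" for b
    using that ls grid by (auto dest!: height_right_less)
  \<comment> \<open>Either some right stop of a left option reaches some left stop of a right
    option, and both stops are inherited, or a number fits between the options and H is itself a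
    number. An empty side falls under the second case.\<close>
  show ?case
  proof (cases "\<exists>a\<in>?A. \<exists>b\<in>?B. b \<le> a")
    case True
    then have ne: "?A \<noteq> {}" "?B \<noteq> {}" by blast+
    have "Max ?A \<in> ?A" "Min ?B \<in> ?B" using ne by (intro Max_in Min_in; simp)+
    then obtain X Y where X: "X |\<in>| lefts H" "Max ?A = rs X" and Y: "Y |\<in>| rights H" "Min ?B = ls Y"
      by blast
    have le: "Min ?B \<le> Max ?A" using True by (meson Max_ge Min_le finite_fset finite_imageI order_trans)
    have "left_stop H (rs X)"
    proof (rule left_stop_hot[of X _ _ Y "ls Y"])
      fix Z assume "Z |\<in>| lefts H"
      then show "\<exists>r\<le>rs X. right_stop Z r"
        using rs by (intro exI[of _ "rs Z"]) (simp flip: X(2))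
    qed (use X Y le ls rs in auto)
    moreover have "right_stop H (ls Y)"
    proof (rule right_stop_hot[of Y _ _ X "rs X"])
      fix Z assume "Z |\<in>| rights H"
      then show "\<exists>l\<ge>ls Y. left_stop Z l"
        using ls by (intro exI[of _ "ls Z"]) (simp flip: Y(2))
    qed (use X Y le ls rs in auto)
    moreover have "rs X \<in> stop_grid (height H)" "ls Y \<in> stop_grid (height H)"
      using A B X(1) Y(1) stop_grid_mono[of "height H - 1" "height H"] by auto
    ultimately show ?thesis by blast
  next
    case False
    show ?thesis
    proof (cases "height H")
      case 0
      then have "lefts H = {||}" "rights H = {||}"
        using height_left_less[of _ H] height_right_less[of _ H] by auto
      then have "H = dyadic_game 0 0" by (cases H) simp
      then show ?thesis using stops_dyadic[of H 0 0] 0 by simp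
    next
      case (Suc k)
      have "\<exists>c\<in>stop_grid (Suc k). (\<forall>a\<in>?A. a < c) \<and> (\<forall>b\<in>?B. c < b)"
        using False A B Suc by (intro stop_grid_between) (auto simp: not_le)
      then obtain c where c: "\<forall>a\<in>?A. a < of_int c / 2 ^ k" "\<forall>b\<in>?B. of_int c / 2 ^ k < b"
        by auto
      have "\<not> dyadic_game c k \<preceq> X" if "X |\<in>| lefts H" for X
        using that rs[of X] c(1) by (simp add: right_stop_def)
      moreover have "\<not> X \<preceq> dyadic_game c k" if "X |\<in>| rights H" for X
        using that ls[of X] c(2) by (simp add: left_stop_def)
      \<comment> \<open>The simplest fitting number may differ from the chosen one, but its exponent
        is no larger, so it stays in the grid.\<close>
      ultimately obtain m j where mj: "j \<le> k" "H \<approx> dyadic_game m j"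
        using simplest_number by blast
      have "of_int m / 2 ^ j \<in> stop_grid (Suc j)" by simp
      with mj(1) have "of_int m / 2 ^ j \<in> stop_grid (height H)"
        using stop_grid_mono[of "Suc j" "Suc k"] Suc by auto
      then show ?thesis using stops_dyadic[OF mj(2)] by blast
    qed
  qed
qed

section \<open>Stops of a sum that is a number\<close>

lemma stops_of_dyadic_sum:
  assumes "left_stop H (of_int a / 2 ^ n)" "right_stop J (of_int b / 2 ^ n)"
    and sum: "H \<oplus> J \<approx> dyadic_game m n"
  shows "a + b = m"
proof (rule ccontr)
  assume neq: "a + b \<noteq> m"
  \<comment> \<open>Half of the discrepancy d goes to each stop. The resulting numbers z and y sum
    to the value of \<open>H \<oplus> J\<close> and lie strictly on the same side of the two stops,
    where the comparisons are decided; cancellation then contradicts one of them.\<close>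
  define d where "d = m - a - b"
  let ?z = "dyadic_game (2 * a + d) (Suc n)" and ?y = "dyadic_game (2 * b + d) (Suc n)"
  have "(2 * a + d) + (2 * b + d) = 2 * m" by (simp add: d_def)
  then have "?z \<oplus> ?y \<approx> dyadic_game (2 * m) (Suc n)"
    using dyadic_game_plus[of "2 * a + d" "Suc n" "2 * b + d"] by (simp del: dyadic_game.simps)
  then have zy: "?z \<oplus> ?y \<approx> H \<oplus> J"
    using game_eq_trans[OF _ game_eq_sym[OF sum]] by simp
  have val: "(of_int (2 * c + d) / 2 ^ Suc n :: rat) = of_int c / 2 ^ n + of_int d / 2 ^ Suc n" for c
    by (simp add: field_simps)
  consider "d > 0" | "d < 0" using neq unfolding d_def by linarith
  then show False
  proof cases
    case 1
    then have "of_int a / 2 ^ n < (of_int (2 * a + d) / 2 ^ Suc n :: rat)"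
      "of_int b / 2 ^ n < (of_int (2 * b + d) / 2 ^ Suc n :: rat)" unfolding val by simp_all
    then have "H \<preceq> ?z" "\<not> ?y \<preceq> J"
      using assms unfolding left_stop_def right_stop_def by blast+
    moreover from this have "?z \<oplus> ?y \<preceq> ?z \<oplus> J"
      using zy game_le_trans[of "?z \<oplus> ?y" "H \<oplus> J" "?z \<oplus> J"]
      by (simp add: game_eq_def del: plus_le_cancel_left dyadic_game.simps)
    ultimately show False by (simp del: dyadic_game.simps)
  next
    case 2
    then have "(of_int (2 * a + d) / 2 ^ Suc n :: rat) < of_int a / 2 ^ n"
      "(of_int (2 * b + d) / 2 ^ Suc n :: rat) < of_int b / 2 ^ n" unfolding val by (simp_all add: divide_neg_pos)
    then have "?y \<preceq> J" "\<not> H \<preceq> ?z"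
      using assms unfolding left_stop_def right_stop_def by blast+
    moreover have "H \<oplus> ?y \<preceq> H \<oplus> J"
      using \<open>?y \<preceq> J\<close> by simp
    then have "H \<oplus> ?y \<preceq> ?z \<oplus> ?y"
      using zy game_le_trans unfolding game_eq_def by blast
    ultimately show False by (simp del: dyadic_game.simps)
  qed
qed

section \<open>Decompositions of numbers\<close>

lemma dyadic_game_reduce:
  "\<exists>m' n'. dyadic_game m n = dyadic_game m' n' \<and> of_int m / 2 ^ n = (of_int m' / 2 ^ n' :: rat)
    \<and> (n' = 0 \<or> odd m')"
proof (induction n arbitrary: m)
  case (Suc n)
  show ?case
  proof (cases "even m")
    case True
    then obtain k where "m = 2 * k" by (elim evenE)
    then have "dyadic_game m (Suc n) = dyadic_game k n"
      "of_int m / 2 ^ Suc n = (of_int k / 2 ^ n :: rat)" by simp_all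
    with Suc[of k] show ?thesis by (simp del: dyadic_game.simps)
  qed blast
qed blast

lemma not_decomposable_dyadic_game:
  assumes "n = 0 \<or> odd m" "\<bar>m\<bar> \<le> 2 ^ n"
  shows "\<not> decomposable (dyadic_game m n)"
proof
  assume "decomposable (dyadic_game m n)"
  then obtain H J where HJ: "birthday H < height (dyadic_game m n)"
    "birthday J < height (dyadic_game m n)" "dyadic_game m n \<approx> H \<oplus> J"
    by (auto simp: decomposable_def birthday_dyadic_game)
  let ?H = "canonical_form H" and ?J = "canonical_form J"
  have sum: "?H \<oplus> ?J \<approx> dyadic_game m n"
    using HJ(3) canonical_form(2) game_plus_cong game_eq_sym game_eq_trans by meson
  have "height ?H \<le> n" "height ?J \<le> n"
    using HJ height_dyadic_game_le[OF assms(2)] by (auto simp: birthday_def)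
  then obtain l r where lr: "l \<in> stop_grid n" "left_stop ?H l" "r \<in> stop_grid n" "right_stop ?J r"
    using stops_exist[of ?H] stops_exist[of ?J] stop_grid_mono by (meson subsetD)
  show False
  proof (cases n)
    case 0
    \<comment> \<open>Summands born before an integer of height at most 1 have height 0 and stops 0,
      which leaves m = 0; but nothing is born before 0.\<close>
    then have "m = 0" using lr stops_of_dyadic_sum[of ?H 0 n ?J 0 m] sum by simp
    with 0 HJ(1) show False by simp
  next
    case (Suc k)
    then obtain p q where "l = of_int p / 2 ^ k" "r = of_int q / 2 ^ k" using lr by auto
    \<comment> \<open>Rewritten over the denominator of the sum, both numerators become even, while
      m is odd.\<close>
    then have "l = of_int (2 * p) / 2 ^ n" "r = of_int (2 * q) / 2 ^ n" by (simp_all add: Suc)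
    then have "2 * p + 2 * q = m" using lr sum stops_of_dyadic_sum by blast
    then show False using assms(1) Suc by auto
  qed
qed

text \<open>Applied to x - 1 > 0: then x has height at least 2, so the summand 1 is born strictly
  earlier.\<close>

lemma height_dyadic_game_pos: "m > 0 \<Longrightarrow> height (dyadic_game m n) > 0"
proof (rule ccontr)
  assume "m > 0" "\<not> height (dyadic_game m n) > 0"
  then have "lefts (dyadic_game m n) = {||}"
    using height_left_less[of _ "dyadic_game m n"] by auto
  then have "dyadic_game m n \<preceq> dyadic_game 0 n"
    using dyadic_game_scale[of 0 n 0] by (intro game_leI) auto
  with \<open>m > 0\<close> show False by (simp add: dyadic_game_le_iff)
qed

lemma decomposable_dyadic_game:
  assumes "\<bar>m\<bar> > 2 ^ n"
  shows "decomposable (dyadic_game m n)"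
proof -
  have one: "dyadic_game (2 ^ n) n = dyadic_game 1 0" using dyadic_game_scale[of 1 n 0] by simp
  have less: "height (dyadic_game (c - 2 ^ n) n) < height (dyadic_game c n)"
    "height (dyadic_game (2 ^ n) n) < height (dyadic_game c n)" if "c > 2 ^ n" for c
    using height_dyadic_game_add_one[of "c - 2 ^ n" n] height_dyadic_game_pos[of "c - 2 ^ n" n] that
    by (simp_all add: one)
  define s :: int where "s = (if m > 0 then 2 ^ n else - (2 ^ n))"
  have "height (dyadic_game (m - s) n) < height (dyadic_game m n)
      \<and> height (dyadic_game s n) < height (dyadic_game m n)"
  proof (cases "m > 0")
    case True
    with assms less[of m] show ?thesis by (simp add: s_def)
  next
    case False
    with assms less[of "- m"] height_dyadic_game_uminus[of "m + 2 ^ n" n] show ?thesis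
      by (simp add: s_def height_dyadic_game_uminus)
  qed
  moreover have "dyadic_game m n \<approx> dyadic_game (m - s) n \<oplus> dyadic_game s n"
    using game_eq_sym[OF dyadic_game_plus[of "m - s" n s]] by simp
  ultimately show ?thesis
    unfolding decomposable_def birthday_dyadic_game by (metis birthday_dyadic_game)
qed

lemma decomposable_cong:
  assumes "G \<approx> H"
  shows "decomposable G \<longleftrightarrow> decomposable H"
proof -
  have "G \<approx> K \<longleftrightarrow> H \<approx> K" for K
    using assms game_eq_sym game_eq_trans by blast
  then show ?thesis by (simp add: decomposable_def birthday_cong[OF assms])
qed

theorem theorem14:
  fixes G :: game and x :: rat
  assumes "has_number_value G x"
  shows "indecomposable G \<longleftrightarrow> \<bar>x\<bar> \<le> 1"
proof -
  obtain m n where "x = of_int m / 2 ^ n" "G \<approx> dyadic_game m n"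
    using assms by (auto simp: has_number_value_def)
  \<comment> \<open>The given fraction may be unreduced, whereas the parity argument needs an odd
    numerator unless the denominator is 1.\<close>
  then obtain m n where x: "x = of_int m / 2 ^ n" "G \<approx> dyadic_game m n" "n = 0 \<or> odd m"
    using dyadic_game_reduce by metis
  have "\<bar>x\<bar> \<le> 1 \<longleftrightarrow> \<bar>of_int m\<bar> \<le> (2 ^ n :: rat)"
    by (simp add: x abs_divide)
  also have "\<dots> \<longleftrightarrow> \<bar>m\<bar> \<le> 2 ^ n"
    by (metis of_int_abs of_int_le_iff of_int_numeral of_int_power)
  finally show ?thesis
    using decomposable_cong[OF x(2)] not_decomposable_dyadic_game[OF x(3)]
      decomposable_dyadic_game[of n m]
    by (auto simp: indecomposable_def)
qed

end
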